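(* Let $n,k$ be positive integers with $k\mid n$, and for $i\in\mathbb{Z}_{2^{n-k}}$ let $t_i$ be positive integers with $k\mid t_i$ and $a_i\in\mathbb{F}_{2^n}$. Let $v_0,\dots,v_{2^{n-k}-1}$ be representatives of the (additive) cosets of $\mathbb{F}_{2^n}$ modulo $\mathbb{F}_{2^k}$, and define $f(x)={\rm Tr}_1^n(a_ix^{2^{t_i}+1})$ if $x\in v_i+\mathbb{F}_{2^k}$. Then for every $b\in\mathbb{F}_{2^n}$, $$\widehat f(b)=2^k\sum_{i\in E(b)}(-1)^{{\rm Tr}_1^n(a_iv_i^{2^{t_i}+1}+bv_i)},$$ where $E(b)=\{i\in\mathbb{Z}_{2^{n-k}}: {\rm Tr}_k^n(b)={\rm Tr}_k^n(a_i(v_i^{2^{t_i}}+v_i)+a_i^{2^{-1}})\}$.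
   Context: ${\rm Tr}_k^n(x)=\sum_{j=0}^{n/k-1}x^{2^{kj}}$ is the relative trace from $\mathbb{F}_{2^n}$ to $\mathbb{F}_{2^k}$, ${\rm Tr}_1^n$ the absolute trace; $a^{2^{-1}}$ denotes the unique square root of $a$ in $\mathbb{F}_{2^n}$. Walsh transform $\widehat f(b)=\sum_{x\in\mathbb{F}_{2^n}}(-1)^{f(x)+{\rm Tr}_1^n(bx)}$. *)

theory Defs
  imports "HOL-Algebra.Algebraic_Closure_Type" "HOL-Library.Cardinality"
begin

text \<open>
  The field with \<open>2 ^ n\<close> elements is a type \<open>'a :: {field, finite}\<close> with \<open>CARD('a) = 2 ^ n\<close>;
  since \<open>n\<close> cannot be a parameter of the type, the trace takes \<open>n\<close> as an explicit argument.
  The prime field is the subset \<open>{0, 1}\<close> of \<open>'a\<close>, and functions with values in it have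
  type \<open>'a \<Rightarrow> 'a\<close>.
\<close>

definition rel_trace :: "nat \<Rightarrow> nat \<Rightarrow> 'a::field \<Rightarrow> 'a" where
  "rel_trace n k x = (\<Sum>j<n div k. x ^ (2 ^ (k * j)))"

abbreviation abs_trace :: "nat \<Rightarrow> 'a::field \<Rightarrow> 'a" where
  "abs_trace n \<equiv> rel_trace n 1"

text \<open>The sign \<open>(-1) ^ u\<close> for \<open>u\<close> in the prime field \<open>{0, 1}\<close>; only meaningful for such \<open>u\<close>.\<close>

definition sign_F2 :: "'a::field \<Rightarrow> int" where
  "sign_F2 u = (if u = 0 then 1 else - 1)"

definition walsh :: "nat \<Rightarrow> ('a::{field,finite} \<Rightarrow> 'a) \<Rightarrow> 'a \<Rightarrow> int" where
  "walsh n f b = (\<Sum>x\<in>UNIV. sign_F2 (f x + abs_trace n (b * x)))"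

text \<open>The square root exists and is unique in a finite field of characteristic 2, where squaring is bijective.\<close>

definition sqrt_char2 :: "'a::field \<Rightarrow> 'a" where
  "sqrt_char2 a = (THE c. c ^ 2 = a)"

end

theory Submission
  imports Defs "HOL-Number_Theory.Residues"
begin

text \<open>
  For \<open>z\<close> in \<open>K\<close> we have \<open>z ^ 2 ^ t = z\<close> whenever \<open>k dvd t\<close>, so on a coset \<open>v + K\<close>
  the function \<open>f (v + z) + Tr (b (v + z))\<close> is the constant \<open>Tr (a v ^ (2 ^ t + 1) + b v)\<close>
  plus \<open>Tr (a (v ^ 2 ^ t + v) z + a z\<^sup>2 + b z)\<close>. As \<open>Tr (a z\<^sup>2) = Tr (sqrt a z)\<close>, the latter
  is \<open>Tr (c z)\<close> with \<open>c = a (v ^ 2 ^ t + v) + sqrt a + b\<close>, so each coset contributes a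
  character sum over \<open>K\<close>. By transitivity of the trace, \<open>z \<mapsto> Tr (c z)\<close> is given on \<open>K\<close> by a
  polynomial of degree less than \<open>card K\<close> with linear coefficient \<open>Tr_k^n c\<close>; hence the
  character is trivial iff \<open>Tr_k^n c = 0\<close>.
\<close>

section \<open>Frobenius powers and characteristic 2\<close>

text \<open>Multiplication by a nonzero \<open>z\<close> permutes the nonzero elements of
  \<open>S\<close>; comparing their products forces \<open>z ^ (card S - 1) = 1\<close>. Used for
  the subfield and for the whole field.\<close>

lemma power_card_eq_self:
  fixes z :: "'a::field"
  assumes "finite S" and "0 \<in> S" and "\<And>x y. x \<in> S \<Longrightarrow> y \<in> S \<Longrightarrow> x * y \<in> S" and "z \<in> S"
  shows "z ^ card S = z"
proof (cases "z = 0")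
  case True
  then show ?thesis using assms(1,2) by (auto simp: power_0_left)
next
  case False
  have inj: "inj_on ((*) z) (S - {0})" using False by (auto simp: inj_on_def)
  have "(*) z ` (S - {0}) \<subseteq> S - {0}" using assms False by auto
  then have img: "(*) z ` (S - {0}) = S - {0}"
    using endo_inj_surj[OF _ _ inj] assms(1) by blast
  have "(\<Prod>y\<in>S - {0}. y) = (\<Prod>y\<in>S - {0}. z * y)"
    using prod.reindex[OF inj, of "\<lambda>y. y"] img by simp
  also have "\<dots> = z ^ (card S - 1) * (\<Prod>y\<in>S - {0}. y)"
    using assms(1,2) by (simp add: prod.distrib)
  finally have "z ^ (card S - 1) = 1"
    using assms(1) by simp
  moreover have "card S > 0" using assms(1,2) card_gt_0_iff by blast
  ultimately show ?thesis
    by (metis Suc_diff_1 mult.right_neutral power_Suc)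
qed

lemma power_iterate_eq_self:
  fixes z :: "'a::monoid_mult"
  assumes "z ^ (2 ^ k) = z" and "k dvd t"
  shows "z ^ (2 ^ t) = z"
proof -
  obtain j where t: "t = k * j" using assms(2) by auto
  have "z ^ (2 ^ (k * j)) = z"
    by (induction j) (simp_all add: assms(1) power_add power_mult)
  then show ?thesis by (simp add: t)
qed

lemma CHAR_eq_2:
  assumes "CARD('a::{field,finite}) = 2 ^ n"
  shows "CHAR('a) = 2"
proof -
  have "prime CHAR('a)"
    by (rule prime_CHAR_semidom) (simp add: finite_imp_CHAR_pos)
  moreover have "CHAR('a) dvd 2 ^ n"
    using CHAR_dvd_CARD[where ?'a = 'a] assms by simp
  ultimately show ?thesis
    by (metis prime_dvd_power primes_dvd_imp_eq two_is_prime_nat)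
qed

lemma power_two_power_add:
  fixes x y :: "'a::field"
  assumes "CHAR('a) = 2"
  shows "(x + y) ^ (2 ^ m) = x ^ (2 ^ m) + y ^ (2 ^ m)"
  by (rule freshmans_dream') (simp_all add: assms)

lemma power_two_power_sum:
  fixes g :: "'b \<Rightarrow> 'a::field"
  assumes "CHAR('a) = 2"
  shows "(\<Sum>i\<in>A. g i) ^ (2 ^ m) = (\<Sum>i\<in>A. g i ^ (2 ^ m))"
  by (rule freshmans_dream_sum') (simp_all add: assms)

lemma add_eq_0_iff_CHAR_2:
  fixes x y :: "'a::field"
  assumes "CHAR('a) = 2"
  shows "x + y = 0 \<longleftrightarrow> x = y"
  by (metis assms eq_iff_diff_eq_0 minus_CHAR_2)

section \<open>Trace identities\<close>

lemma rel_trace_add: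
  fixes x y :: "'a::field"
  assumes "CHAR('a) = 2"
  shows "rel_trace n k (x + y) = rel_trace n k x + rel_trace n k y"
  by (simp add: rel_trace_def power_two_power_add[OF assms] sum.distrib)

lemma abs_trace_square:
  fixes x :: "'a::field"
  assumes "x ^ (2 ^ n) = x"
  shows "abs_trace n (x\<^sup>2) = abs_trace n x"
proof -
  have "abs_trace n (x\<^sup>2) = (\<Sum>j<n. x ^ (2 ^ Suc j))"
    by (simp add: rel_trace_def power_mult)
  \<comment> \<open>Both sums are the sum over \<open>j < Suc n\<close> with one end term removed:
    the first, \<open>x\<close>, or the last, \<open>x ^ (2 ^ n)\<close>, and these agree.\<close>
  also have "\<dots> = (\<Sum>j<n. x ^ (2 ^ j))"
    using sum.lessThan_Suc_shift[of "\<lambda>j. x ^ (2 ^ j)" n]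
      sum.lessThan_Suc[of "\<lambda>j. x ^ (2 ^ j)" n] assms
    by (simp add: add.commute)
  finally show ?thesis by (simp add: rel_trace_def)
qed

text \<open>The trace is its own square, and in a field only 0 and 1 are.\<close>

lemma abs_trace_in_F2:
  fixes x :: "'a::field"
  assumes "CHAR('a) = 2" and "x ^ (2 ^ n) = x"
  shows "abs_trace n x \<in> {0, 1}"
proof -
  have "(abs_trace n x)\<^sup>2 = (\<Sum>j<n. (x ^ (2 ^ j))\<^sup>2)"
    using power_two_power_sum[OF assms(1), of "\<lambda>j. x ^ (2 ^ j)" _ 1] by (simp add: rel_trace_def)
  also have "\<dots> = abs_trace n (x\<^sup>2)"
    by (simp add: rel_trace_def mult.commute flip: power_mult)
  finally have "(abs_trace n x)\<^sup>2 = abs_trace n x"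
    using abs_trace_square[OF assms(2)] by simp
  then show ?thesis by (simp add: power2_eq_square)
qed

text \<open>Transitivity of the trace: \<open>z\<close> is fixed by the powers
  \<open>2 ^ (k * j)\<close>, so it moves inside the relative trace, and the exponents
  \<open>k * j + i\<close> with \<open>i < k\<close> and \<open>j < n div k\<close> run once through
  all numbers below \<open>n\<close>.\<close>

lemma abs_trace_mult_rel_trace:
  fixes c z :: "'a::field"
  assumes "CHAR('a) = 2" and "k dvd n" and "z ^ (2 ^ k) = z"
  shows "abs_trace n (z * c) = abs_trace k (z * rel_trace n k c)"
proof -
  let ?g = "\<lambda>j. (z * c) ^ (2 ^ j)"
  have "z * rel_trace n k c = (\<Sum>j<n div k. ?g (k * j))"
    using power_iterate_eq_self[OF assms(3)]
    by (simp add: rel_trace_def sum_distrib_left power_mult_distrib)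
  then have "abs_trace k (z * rel_trace n k c) = (\<Sum>i<k. \<Sum>j<n div k. ?g (k * j + i))"
    by (simp add: rel_trace_def power_two_power_sum[OF assms(1)] power_add flip: power_mult)
  also have "\<dots> = (\<Sum>j<n div k. \<Sum>i<k. ?g (j * k + i))"
    by (subst sum.swap) (simp add: mult.commute)
  also have "\<dots> = (\<Sum>j<n div k. sum ?g {j * k..<j * k + k})"
  proof (rule sum.cong[OF refl])
    fix j
    show "(\<Sum>i<k. ?g (j * k + i)) = sum ?g {j * k..<j * k + k}"
      using sum.shift_bounds_nat_ivl[of ?g 0 "j * k" k]
      by (simp add: atLeast0LessThan add.commute)
  qed
  also have "\<dots> = sum ?g {..<n div k * k}" by (rule sum.nat_group)
  also have "\<dots> = abs_trace n (z * c)" using assms(2) by (simp add: rel_trace_def)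
  finally show ?thesis by simp
qed

text \<open>
  On a set with at least \<open>2 ^ k\<close> elements, the polynomial \<open>\<Sum>i<k. w ^ 2 ^ i X ^ 2 ^ i\<close> of degree
  at most \<open>2 ^ (k - 1)\<close> cannot vanish, since its linear coefficient is \<open>w\<close>.
\<close>

lemma ex_abs_trace_mult_nonzero:
  fixes w :: "'a::field"
  assumes "k > 0" and "card S \<ge> 2 ^ k" and "w \<noteq> 0"
  shows "\<exists>z\<in>S. abs_trace k (z * w) \<noteq> 0"
proof (rule ccontr)
  assume contra: "\<not> ?thesis"
  define p where "p = (\<Sum>i<k. monom (w ^ (2 ^ i)) (2 ^ i))"
  have poly_p: "poly p z = abs_trace k (z * w)" for z
    by (simp add: p_def rel_trace_def poly_sum poly_monom power_mult_distrib mult.commute)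
  \<comment> \<open>The exponent \<open>2 ^ i\<close> equals 1 only for
    \<open>i = 0\<close>.\<close>
  have "coeff p 1 = (\<Sum>i<k. if i = 0 then w else 0)"
    unfolding p_def coeff_sum by (rule sum.cong) auto
  also have "\<dots> = w" using assms(1) by simp
  finally have "p \<noteq> 0" using assms(3) by auto
  have "degree p \<le> 2 ^ (k - 1)"
    unfolding p_def
  proof (rule degree_sum_le)
    fix i assume "i \<in> {..<k}"
    then have "(2::nat) ^ i \<le> 2 ^ (k - 1)" by (intro power_increasing) auto
    then show "degree (monom (w ^ (2 ^ i)) (2 ^ i)) \<le> 2 ^ (k - 1)"
      using degree_monom_le le_trans by blast
  qed simp
  also have "\<dots> < (2::nat) ^ k" using assms(1) by simp
  also have "\<dots> \<le> card {z. poly p z = 0}"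
  proof -
    have "S \<subseteq> {z. poly p z = 0}" using contra poly_p by auto
    then show ?thesis
      using assms(2) card_mono[OF poly_roots_finite[OF \<open>p \<noteq> 0\<close>]] le_trans by blast
  qed
  finally show False using card_poly_roots_bound[OF \<open>p \<noteq> 0\<close>] by simp
qed

section \<open>Character sums over the subfield\<close>

lemma sign_F2_add:
  fixes u w :: "'a::field"
  assumes "CHAR('a) = 2" and "u \<in> {0, 1}" and "w \<in> {0, 1}"
  shows "sign_F2 (u + w) = sign_F2 u * sign_F2 w"
  using assms add_eq_0_iff_CHAR_2[OF assms(1), of u w] by (auto simp: sign_F2_def)

text \<open>Translation by \<open>z\<^sub>0\<close> permutes \<open>K\<close> and flips every sign,
  so the sum equals its own negative.\<close>

lemma sum_sign_F2_additive:
  fixes L :: "'a::field \<Rightarrow> 'a"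
  assumes char2: "CHAR('a) = 2"
    and K: "finite K" "\<And>x y. x \<in> K \<Longrightarrow> y \<in> K \<Longrightarrow> x + y \<in> K"
    and L: "\<And>x y. L (x + y) = L x + L y" "\<And>x. x \<in> K \<Longrightarrow> L x \<in> {0, 1}"
    and z0: "z\<^sub>0 \<in> K" "L z\<^sub>0 \<noteq> 0"
  shows "(\<Sum>z\<in>K. sign_F2 (L z)) = 0"
proof -
  \<comment> \<open>In characteristic 2 the translation is its own inverse, hence both witnesses of
    the reindexing coincide.\<close>
  have cancel: "z\<^sub>0 + (z\<^sub>0 + z) = z" for z
    using add_eq_0_iff_CHAR_2[OF char2, of z\<^sub>0 z\<^sub>0] by (simp flip: add.assoc)
  have "(\<Sum>z\<in>K. sign_F2 (L z)) = (\<Sum>z\<in>K. sign_F2 (L (z\<^sub>0 + z)))"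
    by (rule sum.reindex_bij_witness[of _ "(+) z\<^sub>0" "(+) z\<^sub>0"]) (use cancel K z0 in auto)
  also have "\<dots> = (\<Sum>z\<in>K. - sign_F2 (L z))"
  proof (rule sum.cong[OF refl])
    fix z assume "z \<in> K"
    then show "sign_F2 (L (z\<^sub>0 + z)) = - sign_F2 (L z)"
      using sign_F2_add[OF char2 L(2)[OF z0(1)] L(2)] z0(2) by (simp add: L(1) sign_F2_def)
  qed
  finally show ?thesis by (simp add: sum_negf)
qed

text \<open>Orthogonality: by transitivity the character depends on \<open>c\<close> only through
  \<open>rel_trace n k c\<close>, and the root bound makes it nontrivial unless that value is
  0.\<close>

lemma sum_sign_F2_abs_trace:
  fixes c :: "'a::{field,finite}"
  assumes char2: "CHAR('a) = 2" and n: "CARD('a) = 2 ^ n" and k: "k > 0" "k dvd n"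
    and K: "card K = 2 ^ k" "\<And>x y. x \<in> K \<Longrightarrow> y \<in> K \<Longrightarrow> x + y \<in> K"
    and pow: "\<And>z. z \<in> K \<Longrightarrow> z ^ (2 ^ k) = z"
  shows "(\<Sum>z\<in>K. sign_F2 (abs_trace n (z * c))) = (if rel_trace n k c = 0 then 2 ^ k else 0)"
proof (cases "rel_trace n k c = 0")
  case True
  have "abs_trace n (z * c) = 0" if "z \<in> K" for z
    using abs_trace_mult_rel_trace[OF char2 k(2) pow[OF that]] True k(1)
    by (simp add: rel_trace_def power_0_left)
  then show ?thesis by (simp add: True K(1) sign_F2_def)
next
  case False
  obtain z where z: "z \<in> K" "abs_trace k (z * rel_trace n k c) \<noteq> 0"
    using ex_abs_trace_mult_nonzero[OF k(1) _ False, where S = K] K(1) by auto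
  have "x ^ (2 ^ n) = x" for x :: 'a
    using power_card_eq_self[of UNIV x] n by simp
  then have "(\<Sum>z\<in>K. sign_F2 (abs_trace n (z * c))) = 0"
    using z abs_trace_mult_rel_trace[OF char2 k(2) pow[OF z(1)]] K(2) abs_trace_in_F2[OF char2]
    by (intro sum_sign_F2_additive[OF char2, where z\<^sub>0 = z])
      (simp_all add: distrib_right rel_trace_add[OF char2])
  with False show ?thesis by simp
qed

text \<open>Justifies the definite description: \<open>x ^ (2 ^ (n - 1))\<close> is a root, and
  raising \<open>y\<^sup>2 = x\<close> to the power \<open>2 ^ (n - 1)\<close> gives back
  \<open>y\<close>.\<close>

lemma sqrt_char2_square:
  fixes x :: "'a::{field,finite}"
  assumes "n > 0" and "CARD('a) = 2 ^ n"
  shows "(sqrt_char2 x)\<^sup>2 = x"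
  unfolding sqrt_char2_def
proof (rule theI)
  have "x ^ (2 ^ n) = x" using power_card_eq_self[of UNIV x] assms(2) by simp
  moreover have "(2::nat) ^ n = 2 ^ (n - 1) * 2"
    using assms(1) by (metis power_minus_mult)
  ultimately show "(x ^ (2 ^ (n - 1)))\<^sup>2 = x" by (simp flip: power_mult)
next
  fix y assume "y\<^sup>2 = x"
  have "y ^ (2 ^ n) = y" using power_card_eq_self[of UNIV y] assms(2) by simp
  moreover have "(2::nat) ^ n = 2 * 2 ^ (n - 1)"
    using assms(1) by (metis power_minus_mult mult.commute)
  ultimately show "y = x ^ (2 ^ (n - 1))"
    using \<open>y\<^sup>2 = x\<close> by (metis power_mult)
qed

section \<open>Summation over cosets and the Walsh transform\<close>

lemma sum_cosets:
  fixes v :: "'i \<Rightarrow> 'a::{ab_group_add,finite}" and g :: "'a \<Rightarrow> 'b::comm_monoid_add"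
  assumes K: "0 \<in> K" "\<And>x y. x \<in> K \<Longrightarrow> y \<in> K \<Longrightarrow> x - y \<in> K"
    and "finite I" and bij: "bij_betw (\<lambda>i. (+) (v i) ` K) I (range (\<lambda>x. (+) x ` K))"
  shows "(\<Sum>x\<in>UNIV. g x) = (\<Sum>i\<in>I. \<Sum>z\<in>K. g (v i + z))"
proof -
  have mem: "x \<in> (+) u ` K \<longleftrightarrow> x - u \<in> K" for x u :: 'a
    by (metis add_diff_cancel_left' add_diff_eq image_iff)
  have neg: "- x \<in> K" if "x \<in> K" for x using K(2)[OF K(1) that] by simp
  \<comment> \<open>Cosets with a common point \<open>x\<close> coincide; by symmetry one inclusion
    suffices. It rests on \<open>y - w = (y - u) - (x - u) + (x - w)\<close>.\<close>
  have subset: "(+) u ` K \<subseteq> (+) w ` K" if "x \<in> (+) u ` K" "x \<in> (+) w ` K" for x u w :: 'a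
  proof
    fix y assume "y \<in> (+) u ` K"
    then have "(y - u) - (x - u) \<in> K" using that(1) K(2) unfolding mem by blast
    then have "((y - u) - (x - u)) - (- (x - w)) \<in> K"
      using that(2) K(2) neg unfolding mem by blast
    then show "y \<in> (+) w ` K" unfolding mem by simp
  qed
  have "(\<Union>i\<in>I. (+) (v i) ` K) = \<Union> (range (\<lambda>x. (+) x ` K))"
    using bij by (simp add: bij_betw_def)
  also have "\<dots> = UNIV" using K(1) by force
  finally have "(\<Sum>x\<in>UNIV. g x) = sum g (\<Union>i\<in>I. (+) (v i) ` K)" by simp
  also have "\<dots> = (\<Sum>i\<in>I. sum g ((+) (v i) ` K))"
  proof (rule sum.UNION_disjoint[OF \<open>finite I\<close>], simp, intro ballI impI equals0I)
    fix i j x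
    assume ij: "i \<in> I" "j \<in> I" "i \<noteq> j" and "x \<in> (+) (v i) ` K \<inter> (+) (v j) ` K"
    then have "(+) (v i) ` K = (+) (v j) ` K" by (intro equalityI subset) auto
    with ij show False using bij unfolding bij_betw_def inj_on_def by auto
  qed
  also have "\<dots> = (\<Sum>i\<in>I. \<Sum>z\<in>K. g (v i + z))"
    by (simp add: sum.reindex)
  finally show ?thesis .
qed

theorem theorem4p1:
  fixes n k :: nat
    and K :: "'a::{field,finite} set"
    and t :: "nat \<Rightarrow> nat"
    and a v :: "nat \<Rightarrow> 'a"
    and f :: "'a \<Rightarrow> 'a"
    and b :: 'a
  assumes "n > 0" and "k > 0" and "k dvd n"
    and "CARD('a) = 2 ^ n"
    and "subfield K (ring_of_type_algebra :: 'a ring)" and "card K = 2 ^ k"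
    and "\<And>i. i < 2 ^ (n - k) \<Longrightarrow> t i > 0 \<and> k dvd t i"
    and "bij_betw (\<lambda>i. (+) (v i) ` K) {..<2 ^ (n - k)} (range (\<lambda>x. (+) x ` K))"
    and "\<And>i x. i < 2 ^ (n - k) \<Longrightarrow> x \<in> (+) (v i) ` K \<Longrightarrow>
           f x = abs_trace n (a i * x ^ (2 ^ t i + 1))"
  shows "walsh n f b =
    2 ^ k * (\<Sum>i\<in>{i. i < 2 ^ (n - k) \<and>
                   rel_trace n k b =
                     rel_trace n k (a i * (v i ^ (2 ^ t i) + v i) + sqrt_char2 (a i))}.
              sign_F2 (abs_trace n (a i * v i ^ (2 ^ t i + 1) + b * v i)))"
proof -
  have char2: "CHAR('a) = 2" by (rule CHAR_eq_2) fact
  have pow_n: "x ^ (2 ^ n) = x" for x :: 'a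
    using power_card_eq_self[of UNIV x] assms(4) by simp
  have K_add: "x + y \<in> K" and K_mult: "x * y \<in> K"
    if "x \<in> K" "y \<in> K" for x y
    using subringE(6,7)[OF subfieldE(1)[OF assms(5)]] that
    by (simp_all add: ring_of_type_algebra_def)
  have zero: "0 \<in> K"
    using subringE(2)[OF subfieldE(1)[OF assms(5)]] by (simp add: ring_of_type_algebra_def)
  have pow_k: "z ^ (2 ^ k) = z" if "z \<in> K" for z
    using power_card_eq_self[of K z] zero K_mult that assms(6) by simp
  \<comment> \<open>The coefficient of \<open>z\<close> inside the trace on the coset of
    \<open>v i\<close>, once the term in \<open>z\<^sup>2\<close> has been made linear.\<close>
  define c where "c i = b + (a i * (v i ^ (2 ^ t i) + v i) + sqrt_char2 (a i))" for i
  define s where "s i = abs_trace n (a i * v i ^ (2 ^ t i + 1) + b * v i)" for i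
  have on_coset: "f (v i + z) + abs_trace n (b * (v i + z)) = s i + abs_trace n (z * c i)"
    if i: "i < 2 ^ (n - k)" and z: "z \<in> K" for i z
  proof -
    have "(v i + z) ^ (2 ^ t i + 1) = (v i ^ (2 ^ t i) + z) * (v i + z)"
      using power_iterate_eq_self[OF pow_k[OF z]] assms(7)[OF i]
      by (simp add: power_two_power_add[OF char2] mult.commute)
    then have expand: "a i * (v i + z) ^ (2 ^ t i + 1) + b * (v i + z) =
        (a i * v i ^ (2 ^ t i + 1) + b * v i) + z * (a i * (v i ^ (2 ^ t i) + v i) + b) + a i * z\<^sup>2"
      by (simp add: algebra_simps power2_eq_square)
    \<comment> \<open>The left argument is the square of the right one, and the trace is invariant
      under squaring.\<close>
    have square: "abs_trace n (a i * z\<^sup>2) = abs_trace n (z * sqrt_char2 (a i))"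
      using abs_trace_square[OF pow_n, of "z * sqrt_char2 (a i)"]
        sqrt_char2_square[OF assms(1,4), of "a i"]
      by (simp add: power_mult_distrib mult.commute)
    have "abs_trace n (a i * (v i + z) ^ (2 ^ t i + 1)) + abs_trace n (b * (v i + z))
        = abs_trace n (a i * (v i + z) ^ (2 ^ t i + 1) + b * (v i + z))"
      by (simp only: rel_trace_add[OF char2])
    also have "\<dots> = s i + abs_trace n (z * (a i * (v i ^ (2 ^ t i) + v i) + b))
          + abs_trace n (z * sqrt_char2 (a i))"
      by (simp only: expand square s_def rel_trace_add[OF char2])
    also have "\<dots> = s i + abs_trace n (z * c i)"
      by (simp only: c_def distrib_left rel_trace_add[OF char2] ac_simps)
    finally show ?thesis using assms(9)[OF i, of "v i + z"] z by simp
  qed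
  have "walsh n f b =
      (\<Sum>i<2 ^ (n - k). \<Sum>z\<in>K. sign_F2 (f (v i + z) + abs_trace n (b * (v i + z))))"
    unfolding walsh_def
    \<comment> \<open>Closure under differences is closure under sums in characteristic 2.\<close>
    by (rule sum_cosets) (use zero K_add assms(8) in \<open>simp_all add: minus_CHAR_2[OF char2]\<close>)
  also have "\<dots> = (\<Sum>i<2 ^ (n - k). sign_F2 (s i) * (\<Sum>z\<in>K. sign_F2 (abs_trace n (z * c i))))"
    unfolding sum_distrib_left
  proof (intro sum.cong refl)
    fix i :: nat and z assume "i \<in> {..<2 ^ (n - k)}" and z: "z \<in> K"
    then have i: "i < 2 ^ (n - k)" by simp
    show "sign_F2 (f (v i + z) + abs_trace n (b * (v i + z))) =
        sign_F2 (s i) * sign_F2 (abs_trace n (z * c i))"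
      unfolding on_coset[OF i z] s_def
      by (intro sign_F2_add abs_trace_in_F2 char2 pow_n)
  qed
  also have "\<dots> = (\<Sum>i<2 ^ (n - k). if rel_trace n k (c i) = 0 then 2 ^ k * sign_F2 (s i) else 0)"
    using sum_sign_F2_abs_trace[OF char2 assms(4,2,3,6) K_add pow_k]
    by (intro sum.cong) simp_all
  also have "\<dots> = (\<Sum>i\<in>{i. i < 2 ^ (n - k) \<and> rel_trace n k (c i) = 0}. 2 ^ k * sign_F2 (s i))"
    by (subst sum.inter_filter[symmetric]) simp_all
  also have "\<dots> = 2 ^ k * (\<Sum>i\<in>{i. i < 2 ^ (n - k) \<and> rel_trace n k (c i) = 0}. sign_F2 (s i))"
    by (simp add: sum_distrib_left)
  \<comment> \<open>In characteristic 2 the trace of \<open>c i\<close> vanishes iff the traces of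
    its two summands agree, which is the index condition of the claim.\<close>
  finally show ?thesis
    by (simp add: c_def s_def rel_trace_add[OF char2, of n k b] add_eq_0_iff_CHAR_2[OF char2])
qed

end
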